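(* Let $1<\upsilon<2$, $0<\mu<1$, $b\in\mathbb{N}$, let $\alpha\in\mathbb{R}$ with $|\alpha|<1$, and assume $e_{\upsilon-\mu,\upsilon}(\alpha,b+2)\neq0$. Let $$I_1=\{(t,s):\upsilon-1\le s\le t\le\upsilon+b+1\},\qquad I_2=\{(t,s):\upsilon-1\le t+1\le s\le\upsilon+b\},$$ with $t\in\mathbb{N}_{\upsilon-2}$ and $s\in\mathbb{N}_{\upsilon-1}$. Then the Green's function of the boundary value problem $$-\Delta^{\upsilon}y(t)+\alpha\,\Delta^{\mu}y(t+\upsilon-\mu)=h(t+\upsilon-1),\quad t\in I=\{0,1,\dots,b+1\},$$ $$y(\upsilon-2)=y(\upsilon+b+1)=0,$$ is $$G(t,s)=\begin{cases}\dfrac{e_{\upsilon-\mu,\upsilon}(\alpha,t-\upsilon+1)}{e_{\upsilon-\mu,\upsilon}(\alpha,b+2)}\,e_{\upsilon-\mu,\upsilon}(\alpha,\upsilon+b-s)-e_{\upsilon-\mu,\upsilon}(\alpha,t-s-1), & (t,s)\in I_1,\\[2ex] \dfrac{e_{\upsilon-\mu,\upsilon}(\alpha,t-\upsilon+1)}{e_{\upsilon-\mu,\upsilon}(\alpha,b+2)}\,e_{\upsilon-\mu,\upsilon}(\alpha,\upsilon+b-s), & (t,s)\in I_2.\end{cases}$$ That is, for every $h:[\upsilon-1,\upsilon+b]_{\mathbb{N}_{\upsilon-1}}\to\mathbb{R}$, the unique solution $y:[\upsilon-2,\upsilon+b+1]_{\mathbb{N}_{\upsilon-2}}\to\mathbb{R}$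 of the problem is $$y(t)=\sum_{s=\upsilon-1}^{\upsilon+b}G(t,s)\,h(s),\qquad t\in[\upsilon-2,\upsilon+b+1]_{\mathbb{N}_{\upsilon-2}}.$$
   Context: Notation: $\mathbb{N}=\{1,2,\dots\}$. For $a\in\mathbb{R}$, $\mathbb{N}_a=\{a,a+1,a+2,\dots\}$, and $[c,c+n]_{\mathbb{N}_c}=\{c,c+1,\dots,c+n\}$. Sums $\sum_{s=\upsilon-1}^{\upsilon+b}$ run over $s=\upsilon-1,\upsilon,\dots,\upsilon+b$. $\Delta$ is the forward difference, $\Delta f(t)=f(t+1)-f(t)$. Falling factorial: $t^{(\nu)}=\frac{\Gamma(t+1)}{\Gamma(t+1-\nu)}$ whenever the right-hand side is well defined, with $t^{(\nu)}=0$ if $t+1-\nu$ is a pole of $\Gamma$ and $t+1$ is not. Fractional sum: for $\nu>0$ and $f$ defined on $\mathbb{N}_a$, $\Delta^{-\nu}f(t)=\frac{1}{\Gamma(\nu)}\sum_{s=a}^{t-\nu}(t-s-1)^{(\nu-1)}f(s)$ (the sum running over $s=a,a+1,\dots,t-\nu$), for $t\in\mathbb{N}_{a+\nu}$. Riemann–Liouville fractional difference: $\Delta^{\nu}f(t)=\Delta^{N}\Delta^{\nu-N}f(t)$, with $N\in\mathbb{N}$, $N-1<\nu\le N$. In the equation, $\Delta^{\upsilon}y$ is taken with $y$ based at $a=\upsilon-2$, i.e. $\Delta^{\upsilon}y(t)=\Delta^2 S(t)$ with $S(\tau)=\frac{1}{\Gamma(2-\upsilon)}\sum_{s=\upsilon-2}^{\tau-2+\upsilon}(\tau-s-1)^{(1-\upsilon)}y(s)$.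 The term $\Delta^{\mu}y(t+\upsilon-\mu)$ means $(\Delta^{\mu}Y_1)(t)$, where $Y_1(t)=y(t+\upsilon-\mu)$ is regarded as a function based at $a=\mu-1$, i.e. $\Delta^{\mu}y(t+\upsilon-\mu)=\Delta T(t)$ with $T(\tau)=\frac{1}{\Gamma(1-\mu)}\sum_{s=\mu-1}^{\tau-1+\mu}(\tau-s-1)^{(-\mu)}y(s+\upsilon-\mu)$. For $t\in I$ these expressions only involve values of $y$ on $[\upsilon-2,\upsilon+b+1]_{\mathbb{N}_{\upsilon-2}}$. Delta discrete Mittag-Leffler function: for $p>0$, $q\in\mathbb{R}$, $|\lambda|<1$ and an integer $n\ge -1$, $$e_{p,q}(\lambda,n)=\sum_{k=0}^{\infty}\lambda^k\frac{(n+kp+q-1)^{(kp+q-1)}}{\Gamma(kp+q)};$$ in particular, $e_{\upsilon-\mu,\upsilon}(\alpha,-1)=0$. *)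

theory Defs
  imports "HOL-Analysis.Analysis"
begin

definition grid :: "real \<Rightarrow> real set" where
  "grid a = {a + real k |k. True}"

definition grid_ivl :: "real \<Rightarrow> real \<Rightarrow> real set" where
  "grid_ivl c d = {x \<in> grid c. x \<le> d}"

definition fwd_diff :: "(real \<Rightarrow> real) \<Rightarrow> real \<Rightarrow> real" where
  "fwd_diff f t = f (t + 1) - f t"

(* Gamma is 0 at its poles and x / 0 = 0, so the value is 0 when t + 1 - \<nu> is a pole and
   t + 1 is not, as the usual convention for the falling factorial requires. *)
definition falling :: "real \<Rightarrow> real \<Rightarrow> real" where
  "falling t \<nu> = Gamma (t + 1) / Gamma (t + 1 - \<nu>)"

(* The fractional sum of order \<nu> > 0 of f based at a, for t in grid (a + \<nu>).
   A function on a grid is a total function, only whose values on the grid are used. *)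
definition frac_sum :: "real \<Rightarrow> real \<Rightarrow> (real \<Rightarrow> real) \<Rightarrow> real \<Rightarrow> real" where
  "frac_sum a \<nu> f t =
     (1 / Gamma \<nu>) * (\<Sum>s\<in>grid_ivl a (t - \<nu>). falling (t - s - 1) (\<nu> - 1) * f s)"

(* Riemann-Liouville difference of order \<nu> > 0 of f based at a, with N - 1 < \<nu> \<le> N.
   For \<nu> = N the inner sum has order 0 and is read as the identity. *)
definition frac_diff :: "real \<Rightarrow> real \<Rightarrow> (real \<Rightarrow> real) \<Rightarrow> real \<Rightarrow> real" where
  "frac_diff a \<nu> f =
     (let N = nat \<lceil>\<nu>\<rceil> in
        (fwd_diff ^^ N) (if \<nu> = real N then f else frac_sum a (real N - \<nu>) f))"

(* n ranges over the integers \<ge> -1; it is typed real since it arises as a difference of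
   grid points. *)
definition mittag_leffler :: "real \<Rightarrow> real \<Rightarrow> real \<Rightarrow> real \<Rightarrow> real" where
  "mittag_leffler p q \<kappa> n =
     (\<Sum>k. \<kappa> ^ k * (falling (n + real k * p + q - 1) (real k * p + q - 1)
                   / Gamma (real k * p + q)))"

definition bvp_solution ::
  "real \<Rightarrow> real \<Rightarrow> real \<Rightarrow> nat \<Rightarrow> (real \<Rightarrow> real) \<Rightarrow> (real \<Rightarrow> real) \<Rightarrow> bool" where
  "bvp_solution \<upsilon> \<mu> \<alpha> b h y \<longleftrightarrow>
     (\<forall>t\<in>grid_ivl 0 (real b + 1).
        - frac_diff (\<upsilon> - 2) \<upsilon> y t + \<alpha> * frac_diff (\<mu> - 1) \<mu> (\<lambda>s. y (s + \<upsilon> - \<mu>)) t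
          = h (t + \<upsilon> - 1)) \<and>
     y (\<upsilon> - 2) = 0 \<and> y (\<upsilon> + real b + 1) = 0"

definition I1 :: "real \<Rightarrow> nat \<Rightarrow> (real \<times> real) set" where
  "I1 \<upsilon> b = {(t, s). t \<in> grid (\<upsilon> - 2) \<and> s \<in> grid (\<upsilon> - 1) \<and>
                       \<upsilon> - 1 \<le> s \<and> s \<le> t \<and> t \<le> \<upsilon> + real b + 1}"

definition I2 :: "real \<Rightarrow> nat \<Rightarrow> (real \<times> real) set" where
  "I2 \<upsilon> b = {(t, s). t \<in> grid (\<upsilon> - 2) \<and> s \<in> grid (\<upsilon> - 1) \<and>
                       \<upsilon> - 1 \<le> t + 1 \<and> t + 1 \<le> s \<and> s \<le> \<upsilon> + real b}"

definition green :: "real \<Rightarrow> real \<Rightarrow> real \<Rightarrow> nat \<Rightarrow> real \<Rightarrow> real \<Rightarrow> real" where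
  "green \<upsilon> \<mu> \<alpha> b t s =
     (let e = mittag_leffler (\<upsilon> - \<mu>) \<upsilon> \<alpha> in
        if (t, s) \<in> I1 \<upsilon> b then
          e (t - \<upsilon> + 1) / e (real b + 2) * e (\<upsilon> + real b - s) - e (t - s - 1)
        else if (t, s) \<in> I2 \<upsilon> b then
          e (t - \<upsilon> + 1) / e (real b + 2) * e (\<upsilon> + real b - s)
        else undefined)"

end

theory Submission
  imports Defs "HOL-Computational_Algebra.Formal_Power_Series" "HOL-Library.Landau_Symbols"
begin

text \<open>
  The proof is a computation with formal power series. Write \<open>B a\<close> for the binomial series
  \<open>(1 - X) powr (- a)\<close>, so that \<open>B a * B c = B (a + c)\<close>. Encode a function \<open>f\<close> on the grid based
  at \<open>a\<close> by the series with coefficients \<open>f (a + j)\<close>. A fractional sum of order \<open>\<nu>\<close> is then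
  multiplication by \<open>B \<nu>\<close>, a forward difference is multiplication by \<open>1 - X\<close> followed by a shift,
  and so a Riemann-Liouville difference of order \<open>\<nu>\<close> is multiplication by \<open>B (- \<nu>)\<close> followed by
  a shift (\<open>frac_diff_eq_fps\<close>).

  For the series \<open>Y\<close> of a function vanishing at the left end point, the difference equation
  therefore prescribes the coefficients of \<open>A * Y\<close> from index \<open>2\<close> up to \<open>b + 3\<close>, where
  \<open>A = B (- \<upsilon>) - \<alpha> B (- \<mu>)\<close>. Expanding \<open>1 / A\<close> as a geometric series,
  \[ 1 / A = \sum_k \alpha^k (1 - X)^{- (k (\upsilon - \mu) + \upsilon)} , \]
  and the coefficients of this series are exactly the Mittag-Leffler values
  (\<open>ml_symbol_times_ml_fps\<close>). Up to index \<open>b + 3\<close> the solutions of the equation are thus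
  \<open>(c X - X\<^sup>2 H) / A\<close>, where \<open>H\<close> is the series of the right-hand side and \<open>c\<close> is free. The right
  boundary condition fixes \<open>c\<close>, because the Mittag-Leffler value at \<open>b + 2\<close> is nonzero, and
  reading off coefficients gives the Green's function. Every step is an equivalence, so existence
  and uniqueness come out together.
\<close>

section \<open>Binomial series\<close>

unbundle no vec_syntax and fps_syntax

text \<open>This is the Taylor series of \<open>(1 - X) powr (- a)\<close>.\<close>

definition binom_fps :: "real \<Rightarrow> real fps" where
  "binom_fps a = Abs_fps (\<lambda>n. pochhammer a n / fact n)"

lemma binom_fps_nth: "binom_fps a $ n = pochhammer a n / fact n"
  by (simp add: binom_fps_def)

lemma binom_fps_add: "binom_fps (a + c) = binom_fps a * binom_fps c"
proof (rule fps_ext)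
  fix n
  have "binom_fps (a + c) $ n
      = (\<Sum>k\<le>n. of_nat (n choose k) * pochhammer a k * pochhammer c (n - k)) / fact n"
    by (simp add: binom_fps_nth pochhammer_binomial_sum)
  also have "\<dots> = (\<Sum>k\<le>n. binom_fps a $ k * binom_fps c $ (n - k))"
    unfolding sum_divide_distrib
    by (intro sum.cong refl) (simp add: binom_fps_nth binomial_fact)
  finally show "binom_fps (a + c) $ n = (binom_fps a * binom_fps c) $ n"
    by (simp add: fps_mult_nth atLeast0AtMost)
qed

lemma binom_fps_0: "binom_fps 0 = 1"
  by (rule fps_ext) (simp add: binom_fps_nth pochhammer_0_left)

lemma binom_fps_minus_1: "binom_fps (- 1) = 1 - fps_X"
proof (rule fps_ext)
  fix n :: nat
  consider "n = 0" | "n = 1" | m where "n = Suc (Suc m)"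
    by (metis One_nat_def not0_implies_Suc)
  then show "binom_fps (- 1) $ n = (1 - fps_X) $ n"
    by cases (simp_all add: binom_fps_nth pochhammer_rec)
qed

lemma binom_fps_minus_of_nat: "binom_fps (- real N) = (1 - fps_X) ^ N"
proof (induction N)
  case (Suc N)
  have "binom_fps (- real (Suc N)) = binom_fps (- 1 + - real N)"
    by (simp add: algebra_simps)
  then show ?case
    using Suc by (simp only: binom_fps_add binom_fps_minus_1 power_Suc)
qed (simp add: binom_fps_0)

lemma binom_fps_nth_Gamma:
  assumes "0 < a"
  shows "binom_fps a $ n = Gamma (real n + a) / (Gamma (real n + 1) * Gamma a)"
  using assms by (simp add: binom_fps_nth pochhammer_Gamma Gamma_fact add.commute nonpos_Ints_def)

section \<open>Fractional sums and differences as products of series\<close>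

lemma grid_ivl_eq_image:
  assumes "d = c + real m"
  shows "grid_ivl c d = (\<lambda>j. c + real j) ` {..m}"
  using assms by (auto simp: grid_ivl_def grid_def)

lemma sum_grid_ivl:
  assumes "d = c + real m"
  shows "(\<Sum>s\<in>grid_ivl c d. f s) = (\<Sum>j\<le>m. f (c + real j))"
  unfolding grid_ivl_eq_image[OF assms] by (subst sum.reindex) (auto simp: inj_on_def)

definition grid_fps :: "real \<Rightarrow> (real \<Rightarrow> real) \<Rightarrow> real fps" where
  "grid_fps a f = Abs_fps (\<lambda>j. f (a + real j))"

lemma grid_fps_nth [simp]: "grid_fps a f $ j = f (a + real j)"
  by (simp add: grid_fps_def)

lemma frac_sum_eq_fps:
  assumes "0 < \<nu>"
  shows "frac_sum a \<nu> f (a + \<nu> + real m) = (binom_fps \<nu> * grid_fps a f) $ m"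
proof -
  have "frac_sum a \<nu> f (a + \<nu> + real m)
      = (1 / Gamma \<nu>) * (\<Sum>j\<le>m. falling (\<nu> + real m - real j - 1) (\<nu> - 1) * f (a + real j))"
    unfolding frac_sum_def by (subst sum_grid_ivl[where m = m]) (auto simp: algebra_simps)
  also have "\<dots> = (\<Sum>j\<le>m. grid_fps a f $ j * binom_fps \<nu> $ (m - j))"
    unfolding sum_distrib_left
  proof (rule sum.cong[OF refl])
    fix j assume "j \<in> {..m}"
    then have "binom_fps \<nu> $ (m - j) = falling (\<nu> + real m - real j - 1) (\<nu> - 1) / Gamma \<nu>"
      using assms by (simp add: binom_fps_nth_Gamma falling_def of_nat_diff algebra_simps)
    then show "1 / Gamma \<nu> * (falling (\<nu> + real m - real j - 1) (\<nu> - 1) * f (a + real j))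
        = grid_fps a f $ j * binom_fps \<nu> $ (m - j)"
      by simp
  qed
  also have "\<dots> = (grid_fps a f * binom_fps \<nu>) $ m"
    by (simp add: fps_mult_nth atLeast0AtMost)
  finally show ?thesis
    by (simp add: mult.commute)
qed

lemma fwd_diff_funpow_eq_fps:
  "(fwd_diff ^^ N) g (c + real t) = ((1 - fps_X) ^ N * grid_fps c g) $ (t + N)"
proof (induction N arbitrary: t)
  case (Suc N)
  have "(fwd_diff ^^ Suc N) g (c + real t)
      = (fwd_diff ^^ N) g (c + real (Suc t)) - (fwd_diff ^^ N) g (c + real t)"
    by (simp add: fwd_diff_def algebra_simps)
  also have "\<dots> = ((1 - fps_X) * ((1 - fps_X) ^ N * grid_fps c g)) $ (t + Suc N)"
    unfolding Suc.IH by (subst left_diff_distrib) simp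
  finally show ?case
    by (simp add: mult.assoc)
qed simp

lemma frac_diff_eq_fps:
  assumes "real N - 1 < \<nu>" "\<nu> < real N"
  shows "frac_diff a \<nu> f (a + (real N - \<nu>) + real t) = (binom_fps (- \<nu>) * grid_fps a f) $ (t + N)"
proof -
  have "\<lceil>\<nu>\<rceil> = int N"
    using assms by (intro ceiling_unique) auto
  then have N: "nat \<lceil>\<nu>\<rceil> = N"
    by simp
  have sum_fps: "grid_fps (a + (real N - \<nu>)) (frac_sum a (real N - \<nu>) f)
      = binom_fps (real N - \<nu>) * grid_fps a f"
    using assms by (intro fps_ext) (simp add: frac_sum_eq_fps)
  have "frac_diff a \<nu> f (a + (real N - \<nu>) + real t)
      = ((1 - fps_X) ^ N * (binom_fps (real N - \<nu>) * grid_fps a f)) $ (t + N)"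
    using assms by (simp add: frac_diff_def N fwd_diff_funpow_eq_fps sum_fps)
  also have "(1 - fps_X) ^ N * (binom_fps (real N - \<nu>) * grid_fps a f)
      = binom_fps (- real N + (real N - \<nu>)) * grid_fps a f"
    by (simp only: binom_fps_add binom_fps_minus_of_nat mult.assoc)
  finally show ?thesis
    by simp
qed

section \<open>The Mittag-Leffler function as a reciprocal series\<close>

text \<open>A Pochhammer symbol grows polynomially in its base, so it cannot spoil geometric decay. The
  induction needs room in the rate \<open>r\<close>, as each further factor is absorbed by enlarging it.\<close>

lemma power_times_pochhammer_bigo:
  fixes \<alpha> p q r :: real
  assumes "\<bar>\<alpha>\<bar> < r"
  shows "(\<lambda>k. \<alpha> ^ k * pochhammer (real k * p + q) n) \<in> O(\<lambda>k. r ^ k)"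
  using assms
proof (induction n arbitrary: r)
  case 0
  then have "\<bar>\<alpha>\<bar> ^ k \<le> r ^ k" for k
    by (intro power_mono) auto
  then show ?case
    using 0 by (intro bigoI[of _ 1] always_eventually) (simp add: power_abs)
next
  case (Suc n)
  define r' where "r' = (\<bar>\<alpha>\<bar> + r) / 2"
  have r': "\<bar>\<alpha>\<bar> < r'" "r' < r"
    using Suc.prems by (simp_all add: r'_def)
  have "(\<lambda>k. \<alpha> ^ k * pochhammer (real k * p + q) n * (real k * p + q + real n))
      \<in> O(\<lambda>k. r' ^ k * (real k * p + q + real n))"
    using Suc.IH[OF r'(1)] by (intro landau_o.big.mult) auto
  also have "(\<lambda>k. r' ^ k * (real k * p + q + real n)) \<in> O(\<lambda>k. r ^ k)"
  proof -
    define C where "C = \<bar>p\<bar> + \<bar>q\<bar> + real n"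
    have "norm (real k * p + q + real n) \<le> C * norm (real k + 1)" for k
    proof -
      have "\<bar>real k * p\<bar> = real k * \<bar>p\<bar>"
        by (simp add: abs_mult)
      then have "\<bar>real k * p + q + real n\<bar> \<le> real k * \<bar>p\<bar> + \<bar>q\<bar> + real n"
        by linarith
      also have "\<dots> \<le> C * (real k + 1)"
        by (simp add: C_def algebra_simps)
      finally show ?thesis
        by simp
    qed
    then have "(\<lambda>k. real k * p + q + real n) \<in> O(\<lambda>k. real k + 1)"
      by (intro bigoI[of _ C] always_eventually) blast
    then have "(\<lambda>k. r' ^ k * (real k * p + q + real n)) \<in> O(\<lambda>k. r' ^ k * (real k + 1))"
      by (intro landau_o.big.mult) auto
    also have "(\<lambda>k. r' ^ k * (real k + 1)) \<in> O(\<lambda>k. r ^ k)"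
    proof -
      have pos: "0 < r'" "0 < r"
        using r' by auto
      define z where "z = r' / r"
      have z: "norm z < 1"
        using pos r'(2) by (simp add: z_def)
      have "(\<lambda>k. real k * z ^ k + z ^ k) \<longlonglongrightarrow> 0 + 0"
        by (intro tendsto_add powser_times_n_limit_0 LIMSEQ_power_zero z)
      moreover have "real k * z ^ k + z ^ k = r' ^ k * (real k + 1) / r ^ k" for k
        by (simp add: z_def power_divide distrib_left add_divide_distrib mult.commute add.commute)
      ultimately show ?thesis
        using pos by (intro bigoI_tendsto[where c = 0]) auto
    qed
    finally show ?thesis .
  qed
  finally show ?case
    by (simp add: pochhammer_Suc mult.assoc)
qed

lemma summable_binom_fps_nth:
  assumes "\<bar>\<alpha>\<bar> < 1"
  shows "summable (\<lambda>k. \<alpha> ^ k * binom_fps (real k * p + q) $ n)"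
proof -
  obtain r where r: "\<bar>\<alpha>\<bar> < r" "r < 1"
    using dense assms by blast
  have "summable (\<lambda>k. \<alpha> ^ k * pochhammer (real k * p + q) n)"
    using r by (intro summable_comparison_test_bigo[OF _ power_times_pochhammer_bigo[OF r(1)]])
      (simp add: summable_geometric)
  then show ?thesis
    by (auto dest: summable_divide[where c = "fact n"] simp: binom_fps_nth)
qed

definition ml_fps :: "real \<Rightarrow> real \<Rightarrow> real \<Rightarrow> real fps" where
  "ml_fps p q \<alpha> = Abs_fps (\<lambda>n. mittag_leffler p q \<alpha> (real n))"

lemma ml_fps_nth_binom:
  assumes "0 < p" "0 < q"
  shows "ml_fps p q \<alpha> $ n = (\<Sum>k. \<alpha> ^ k * binom_fps (real k * p + q) $ n)"
proof -
  have "falling (real n + real k * p + q - 1) (real k * p + q - 1) / Gamma (real k * p + q)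
      = binom_fps (real k * p + q) $ n" for k
  proof -
    have "0 < real k * p + q"
      using assms by (simp add: add_nonneg_pos)
    from binom_fps_nth_Gamma[OF this] show ?thesis
      by (simp add: falling_def algebra_simps)
  qed
  then show ?thesis
    by (simp only: ml_fps_def fps_nth_Abs_fps mittag_leffler_def)
qed

text \<open>In every term the denominator of the falling factorial is \<open>Gamma 0\<close>, a pole, so that the term
  vanishes by convention.\<close>

lemma mittag_leffler_minus_1: "mittag_leffler p q \<alpha> (- 1) = 0"
  by (simp add: mittag_leffler_def falling_def)

lemma fps_X_times_ml_fps_nth:
  "(fps_X * ml_fps p q \<alpha>) $ n = mittag_leffler p q \<alpha> (real n - 1)"
  by (simp add: ml_fps_def mittag_leffler_minus_1 of_nat_diff)

lemma binom_fps_times_ml_fps_sums: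
  assumes "\<bar>\<alpha>\<bar> < 1" "0 < p" "0 < q"
  shows "(\<lambda>k. \<alpha> ^ k * binom_fps (real k * p + q + a) $ n) sums ((binom_fps a * ml_fps p q \<alpha>) $ n)"
proof -
  have "(\<lambda>k. \<Sum>i=0..n. binom_fps a $ i * (\<alpha> ^ k * binom_fps (real k * p + q) $ (n - i)))
      sums (\<Sum>i=0..n. binom_fps a $ i * ml_fps p q \<alpha> $ (n - i))"
    unfolding ml_fps_nth_binom[OF assms(2,3)]
    by (intro sums_sum sums_mult summable_sums summable_binom_fps_nth assms)
  moreover have "(\<Sum>i=0..n. binom_fps a $ i * (\<alpha> ^ k * binom_fps (real k * p + q) $ (n - i)))
      = \<alpha> ^ k * binom_fps (real k * p + q + a) $ n" for k
    by (subst add.commute)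
      (simp add: binom_fps_add[of a] fps_mult_nth sum_distrib_left mult.left_commute)
  ultimately show ?thesis
    by (simp add: fps_mult_nth)
qed

text \<open>Multiplying the \<open>k\<close>-th term of the Mittag-Leffler series by \<open>\<alpha> B (- \<mu>)\<close> gives the same as
  multiplying the next term by \<open>B (- \<upsilon>)\<close>, so the difference telescopes.\<close>

lemma ml_symbol_times_ml_fps:
  assumes "\<bar>\<alpha>\<bar> < 1" "\<mu> < \<upsilon>" "0 < \<upsilon>"
  shows "(binom_fps (- \<upsilon>) - fps_const \<alpha> * binom_fps (- \<mu>)) * ml_fps (\<upsilon> - \<mu>) \<upsilon> \<alpha> = 1"
proof (rule fps_ext)
  fix n
  let ?E = "ml_fps (\<upsilon> - \<mu>) \<upsilon> \<alpha>"
  define u where "u k = \<alpha> ^ k * binom_fps (real k * (\<upsilon> - \<mu>)) $ n" for k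
  have "u sums ((binom_fps (- \<upsilon>) * ?E) $ n)"
    using binom_fps_times_ml_fps_sums[of \<alpha> "\<upsilon> - \<mu>" \<upsilon> "- \<upsilon>" n] assms by (simp add: u_def[abs_def])
  moreover have "(\<lambda>k. u (Suc k)) sums (\<alpha> * (binom_fps (- \<mu>) * ?E) $ n)"
    using sums_mult[OF binom_fps_times_ml_fps_sums[of \<alpha> "\<upsilon> - \<mu>" \<upsilon> "- \<mu>" n], of \<alpha>] assms
    by (simp add: u_def[abs_def] algebra_simps)
  ultimately have "(binom_fps (- \<upsilon>) * ?E) $ n = \<alpha> * (binom_fps (- \<mu>) * ?E) $ n + u 0"
    using sums_Suc_iff[of u "\<alpha> * (binom_fps (- \<mu>) * ?E) $ n"] sums_unique2 by blast
  then show "((binom_fps (- \<upsilon>) - fps_const \<alpha> * binom_fps (- \<mu>)) * ?E) $ n = 1 $ n"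
    by (simp add: left_diff_distrib mult.assoc u_def binom_fps_0)
qed

section \<open>Solving the boundary value problem\<close>

lemma fps_mult_nth_cong:
  fixes A F G :: "'a :: comm_semiring_1 fps"
  assumes "\<And>j. j \<le> n \<Longrightarrow> F $ j = G $ j"
  shows "(A * F) $ n = (A * G) $ n"
  using assms by (simp add: fps_mult_nth)

text \<open>Multiplication by a series, hence also by its inverse, sends agreement up to index \<open>N\<close> to
  agreement up to index \<open>N\<close>. This is what allows passing from an equation on a finite time interval
  to full power series.\<close>

lemma fps_mult_eq_upto_iff:
  fixes A E Y R :: "'a :: comm_semiring_1 fps"
  assumes "A * E = 1"
  shows "(\<forall>n\<le>N. (A * Y) $ n = R $ n) \<longleftrightarrow> (\<forall>n\<le>N. Y $ n = (E * R) $ n)"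
proof safe
  fix n assume L: "\<forall>n\<le>N. (A * Y) $ n = R $ n" and "n \<le> N"
  then have "(E * (A * Y)) $ n = (E * R) $ n"
    by (intro fps_mult_nth_cong) auto
  moreover have "E * (A * Y) = Y"
    using assms by (metis mult.assoc mult.commute mult_1)
  ultimately show "Y $ n = (E * R) $ n"
    by simp
next
  fix n assume L: "\<forall>n\<le>N. Y $ n = (E * R) $ n" and "n \<le> N"
  then have "(A * Y) $ n = (A * (E * R)) $ n"
    by (intro fps_mult_nth_cong) auto
  then show "(A * Y) $ n = R $ n"
    using assms by (simp add: mult.assoc[symmetric])
qed

text \<open>The coefficient at index \<open>0\<close> expresses the left boundary condition; the one at index \<open>1\<close> is
  constrained by no equation, hence the free parameter \<open>c\<close>.\<close>

lemma bvp_solution_iff_fps: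
  fixes \<upsilon> \<mu> \<alpha> :: real and h y :: "real \<Rightarrow> real"
  assumes "1 < \<upsilon>" "\<upsilon> < 2" "0 < \<mu>" "\<mu> < 1" "\<alpha> \<noteq> 1"
  defines "Y \<equiv> grid_fps (\<upsilon> - 2) y"
    and "A \<equiv> binom_fps (- \<upsilon>) - fps_const \<alpha> * binom_fps (- \<mu>)"
    and "H \<equiv> grid_fps (\<upsilon> - 1) h"
  shows "bvp_solution \<upsilon> \<mu> \<alpha> b h y \<longleftrightarrow>
    Y $ (b + 3) = 0 \<and>
    (\<exists>c. \<forall>n\<le>b + 3. (A * Y) $ n = (fps_const c * fps_X - fps_X * (fps_X * H)) $ n)"
proof -
  define F where "F = grid_fps (\<mu> - 1) (\<lambda>s. y (s + \<upsilon> - \<mu>))"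
  have F: "F = fps_shift 1 Y"
    by (rule fps_ext) (simp add: F_def Y_def algebra_simps)
  have Y0: "Y $ 0 = y (\<upsilon> - 2)" and Yb: "Y $ (b + 3) = y (\<upsilon> + real b + 1)"
    by (simp_all add: Y_def algebra_simps)
  \<comment> \<open>The constant coefficient of \<open>A\<close> is \<open>1 - \<alpha>\<close>.\<close>
  have AY0: "(A * Y) $ 0 = 0 \<longleftrightarrow> Y $ 0 = 0"
    using assms(5) by (simp add: A_def binom_fps_nth)
  have eqn: "- frac_diff (\<upsilon> - 2) \<upsilon> y (real t)
        + \<alpha> * frac_diff (\<mu> - 1) \<mu> (\<lambda>s. y (s + \<upsilon> - \<mu>)) (real t) = - (A * Y) $ (t + 2)"
    if "Y $ 0 = 0" for t
  proof -
    have "Y = fps_X * F"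
      unfolding F using that by (intro fps_ext) (simp add: fps_X_mult_nth)
    then have "(binom_fps (- \<mu>) * Y) $ (t + 2) = (fps_X * (binom_fps (- \<mu>) * F)) $ (t + 2)"
      by (simp add: mult.left_commute)
    also have "\<dots> = (binom_fps (- \<mu>) * F) $ (t + 1)"
      by simp
    also have "\<dots> = frac_diff (\<mu> - 1) \<mu> (\<lambda>s. y (s + \<upsilon> - \<mu>)) (real t)"
      using frac_diff_eq_fps[of 1 \<mu> "\<mu> - 1" "\<lambda>s. y (s + \<upsilon> - \<mu>)" t] assms(3,4)
      by (simp add: F_def)
    finally have "(binom_fps (- \<mu>) * Y) $ (t + 2)
        = frac_diff (\<mu> - 1) \<mu> (\<lambda>s. y (s + \<upsilon> - \<mu>)) (real t)" .
    moreover have "(binom_fps (- \<upsilon>) * Y) $ (t + 2) = frac_diff (\<upsilon> - 2) \<upsilon> y (real t)"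
      using frac_diff_eq_fps[of 2 \<upsilon> "\<upsilon> - 2" y t] assms(1,2) by (simp add: Y_def)
    ultimately show ?thesis
      by (simp add: A_def left_diff_distrib mult.assoc)
  qed
  have "bvp_solution \<upsilon> \<mu> \<alpha> b h y \<longleftrightarrow> Y $ (b + 3) = 0 \<and> Y $ 0 = 0 \<and>
      (\<forall>t\<le>b + 1. - (A * Y) $ (t + 2) = H $ t)"
  proof -
    have grid: "(\<forall>t\<in>grid_ivl 0 (real b + 1). P t) \<longleftrightarrow> (\<forall>t\<le>b + 1. P (real t))" for P
      by (subst grid_ivl_eq_image[where m = "b + 1"]) auto
    have H: "H $ t = h (real t + \<upsilon> - 1)" for t
      by (simp add: H_def algebra_simps)
    show ?thesis
      unfolding bvp_solution_def grid Y0[symmetric] Yb[symmetric] H[symmetric]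
      by (cases "Y $ 0 = 0") (simp_all only: eqn simp_thms conj_commute)
  qed
  also have "Y $ 0 = 0 \<and> (\<forall>t\<le>b + 1. - (A * Y) $ (t + 2) = H $ t) \<longleftrightarrow>
      (\<exists>c. \<forall>n\<le>b + 3. (A * Y) $ n = (fps_const c * fps_X - fps_X * (fps_X * H)) $ n)"
    (is "?L \<longleftrightarrow> (\<exists>c. ?R c)")
  proof
    assume L: ?L
    have "?R ((A * Y) $ 1)"
    proof safe
      fix n assume n: "n \<le> b + 3"
      consider "n = 0" | "n = 1" | t where "n = t + 2"
        by (metis One_nat_def add_2_eq_Suc' not0_implies_Suc)
      then show "(A * Y) $ n
          = (fps_const ((A * Y) $ 1) * fps_X - fps_X * (fps_X * H)) $ n"
      proof cases
        case 1
        then show ?thesis using L AY0 by simp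
      next
        case 2
        then show ?thesis by simp
      next
        case (3 t)
        then have "t \<le> b + 1" using n by simp
        with L have "- (A * Y) $ (t + 2) = H $ t" by blast
        then show ?thesis using 3 by simp
      qed
    qed
    then show "\<exists>c. ?R c" ..
  next
    assume "\<exists>c. ?R c"
    then obtain c where R: "?R c" ..
    have "(A * Y) $ 0 = (fps_const c * fps_X - fps_X * (fps_X * H)) $ 0"
      using R by blast
    then have "(A * Y) $ 0 = 0"
      by simp
    moreover have "- (A * Y) $ (t + 2) = H $ t" if "t \<le> b + 1" for t
    proof -
      have "t + 2 \<le> b + 3" using that by simp
      with R have "(A * Y) $ (t + 2) = (fps_const c * fps_X - fps_X * (fps_X * H)) $ (t + 2)"
        by blast
      then show ?thesis by simp
    qed
    ultimately show ?L
      using AY0 by blast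
  qed
  finally show ?thesis .
qed

lemma ml_fps_times_rhs_nth:
  fixes h :: "real \<Rightarrow> real" and p q \<alpha> :: real
  assumes "n \<le> b + 3"
  defines "e \<equiv> mittag_leffler p q \<alpha>"
  shows "(ml_fps p q \<alpha> * (fps_const c * fps_X - fps_X * (fps_X * grid_fps a h))) $ n
    = c * e (real n - 1)
      - (\<Sum>i\<le>b + 1. if i < n then e (real n - real i - 2) * h (a + real i) else 0)"
proof -
  let ?E = "ml_fps p q \<alpha>" and ?H = "grid_fps a h"
  have "(?H * (fps_X * (fps_X * ?E))) $ n
      = (\<Sum>i\<le>n. ?H $ i * (fps_X * (fps_X * ?E)) $ (n - i))"
    by (simp only: fps_mult_nth[of ?H] atLeast0AtMost)
  also have "\<dots> = (\<Sum>i\<le>b + 3. if i < n then e (real n - real i - 2) * h (a + real i) else 0)"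
  proof (rule sum.mono_neutral_cong_left)
    fix i assume "i \<in> {..n}"
    moreover have "(fps_X * (fps_X * ?E)) $ (n - i) = e (real n - real i - 2)" if "i < n"
    proof -
      have "(fps_X * (fps_X * ?E)) $ (n - i) = (fps_X * ?E) $ (n - i - 1)"
        using that by (subst fps_X_mult_nth) simp
      then show ?thesis
        using that by (simp only: fps_X_times_ml_fps_nth e_def) (simp add: of_nat_diff algebra_simps)
    qed
    ultimately show "?H $ i * (fps_X * (fps_X * ?E)) $ (n - i)
        = (if i < n then e (real n - real i - 2) * h (a + real i) else 0)"
      by (auto simp: mult.commute)
  qed (use assms in auto)
  also have "\<dots> = (\<Sum>i\<le>b + 1. if i < n then e (real n - real i - 2) * h (a + real i) else 0)"
  proof (rule sum.mono_neutral_right)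
    \<comment> \<open>The only index to drop that lies below \<open>n\<close> is \<open>b + 2 = n - 1\<close>, where \<open>e\<close> is evaluated at \<open>- 1\<close>.\<close>
    show "\<forall>i\<in>{..b + 3} - {..b + 1}.
        (if i < n then e (real n - real i - 2) * h (a + real i) else 0) = 0"
    proof
      fix i assume i: "i \<in> {..b + 3} - {..b + 1}"
      have "e (real n - real i - 2) = 0" if "i < n"
      proof -
        have "n = i + 1"
          using assms i that by auto
        then show ?thesis
          by (simp add: e_def mittag_leffler_minus_1)
      qed
      then show "(if i < n then e (real n - real i - 2) * h (a + real i) else 0) = 0"
        by simp
    qed
  qed auto
  finally have conv: "(?H * (fps_X * (fps_X * ?E))) $ n
      = (\<Sum>i\<le>b + 1. if i < n then e (real n - real i - 2) * h (a + real i) else 0)" .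
  have "?E * (fps_const c * fps_X - fps_X * (fps_X * ?H))
      = fps_const c * (fps_X * ?E) - ?H * (fps_X * (fps_X * ?E))"
    by (simp add: algebra_simps)
  then have "(?E * (fps_const c * fps_X - fps_X * (fps_X * ?H))) $ n
      = c * (fps_X * ?E) $ n - (?H * (fps_X * (fps_X * ?E))) $ n"
    by (simp only: fps_sub_nth fps_mult_left_const_nth)
  then show ?thesis
    unfolding conv fps_X_times_ml_fps_nth e_def .
qed

lemma green_at_grid:
  fixes \<upsilon> \<mu> \<alpha> :: real
  assumes "n \<le> b + 3" "i \<le> b + 1"
  defines "e \<equiv> mittag_leffler (\<upsilon> - \<mu>) \<upsilon> \<alpha>"
  shows "green \<upsilon> \<mu> \<alpha> b (\<upsilon> - 2 + real n) (\<upsilon> - 1 + real i)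
    = e (real n - 1) / e (real b + 2) * e (real b + 1 - real i)
      - (if i < n then e (real n - real i - 2) else 0)"
proof -
  have g: "\<upsilon> - 2 + real n \<in> grid (\<upsilon> - 2)" "\<upsilon> - 1 + real i \<in> grid (\<upsilon> - 1)"
    by (auto simp: grid_def)
  have "(\<upsilon> - 2 + real n, \<upsilon> - 1 + real i) \<in> I1 \<upsilon> b \<longleftrightarrow> i < n"
    using g assms(1) by (auto simp: I1_def)
  moreover have "(\<upsilon> - 2 + real n, \<upsilon> - 1 + real i) \<in> I2 \<upsilon> b \<longleftrightarrow> \<not> i < n"
    using g assms(2) by (auto simp: I2_def)
  moreover have "\<upsilon> - 2 + real n - \<upsilon> + 1 = real n - 1"
    "\<upsilon> + real b - (\<upsilon> - 1 + real i) = real b + 1 - real i"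
    "\<upsilon> - 2 + real n - (\<upsilon> - 1 + real i) - 1 = real n - real i - 2"
    by simp_all
  ultimately show ?thesis
    by (cases "i < n") (simp_all only: green_def Let_def e_def if_True if_False simp_thms diff_0_right)
qed

lemma bvp_solution_iff_green:
  fixes \<upsilon> \<mu> \<alpha> :: real and h y :: "real \<Rightarrow> real"
  assumes "1 < \<upsilon>" "\<upsilon> < 2" "0 < \<mu>" "\<mu> < 1" "\<bar>\<alpha>\<bar> < 1"
    and nz: "mittag_leffler (\<upsilon> - \<mu>) \<upsilon> \<alpha> (real b + 2) \<noteq> 0"
  shows "bvp_solution \<upsilon> \<mu> \<alpha> b h y \<longleftrightarrow>
    (\<forall>t\<in>grid_ivl (\<upsilon> - 2) (\<upsilon> + real b + 1).
      y t = (\<Sum>s\<in>grid_ivl (\<upsilon> - 1) (\<upsilon> + real b). green \<upsilon> \<mu> \<alpha> b t s * h s))"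
proof -
  define e where "e = mittag_leffler (\<upsilon> - \<mu>) \<upsilon> \<alpha>"
  define Y where "Y n = y (\<upsilon> - 2 + real n)" for n
  define H where "H i = h (\<upsilon> - 1 + real i)" for i
  define S where "S n = (\<Sum>i\<le>b + 1. if i < n then e (real n - real i - 2) * H i else 0)" for n
  define c where "c = S (b + 3) / e (real b + 2)"
  have nz': "e (real b + 2) \<noteq> 0"
    using nz by (simp add: e_def)
  have S_last: "S (b + 3) = (\<Sum>i\<le>b + 1. e (real b + 1 - real i) * H i)"
    unfolding S_def by (rule sum.cong) (auto simp: algebra_simps)
  have green: "(\<Sum>s\<in>grid_ivl (\<upsilon> - 1) (\<upsilon> + real b). green \<upsilon> \<mu> \<alpha> b (\<upsilon> - 2 + real n) s * h s)
      = c * e (real n - 1) - S n" if "n \<le> b + 3" for n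
  proof -
    have "(\<Sum>s\<in>grid_ivl (\<upsilon> - 1) (\<upsilon> + real b). green \<upsilon> \<mu> \<alpha> b (\<upsilon> - 2 + real n) s * h s)
        = (\<Sum>i\<le>b + 1. green \<upsilon> \<mu> \<alpha> b (\<upsilon> - 2 + real n) (\<upsilon> - 1 + real i) * H i)"
      unfolding H_def by (rule sum_grid_ivl) simp
    also have "\<dots> = (\<Sum>i\<le>b + 1. e (real n - 1) / e (real b + 2) * (e (real b + 1 - real i) * H i)
        - (if i < n then e (real n - real i - 2) * H i else 0))"
    proof (rule sum.cong[OF refl])
      fix i assume "i \<in> {..b + 1}"
      then have i: "i \<le> b + 1"
        by simp
      show "green \<upsilon> \<mu> \<alpha> b (\<upsilon> - 2 + real n) (\<upsilon> - 1 + real i) * H i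
          = e (real n - 1) / e (real b + 2) * (e (real b + 1 - real i) * H i)
            - (if i < n then e (real n - real i - 2) * H i else 0)"
        unfolding green_at_grid[OF that i] e_def by (simp add: left_diff_distrib mult.assoc)
    qed
    also have "\<dots> = e (real n - 1) / e (real b + 2) * S (b + 3) - S n"
      by (simp only: sum_subtractf sum_distrib_left[symmetric] S_last[symmetric] S_def[of n])
    finally show ?thesis
      by (simp add: c_def)
  qed
  have "bvp_solution \<upsilon> \<mu> \<alpha> b h y \<longleftrightarrow>
      Y (b + 3) = 0 \<and> (\<exists>c. \<forall>n\<le>b + 3. Y n = c * e (real n - 1) - S n)"
  proof -
    have \<alpha>: "\<alpha> \<noteq> 1"
      using assms by auto
    have inverse: "(binom_fps (- \<upsilon>) - fps_const \<alpha> * binom_fps (- \<mu>)) * ml_fps (\<upsilon> - \<mu>) \<upsilon> \<alpha> = 1"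
      using assms by (intro ml_symbol_times_ml_fps) auto
    let ?P = "\<lambda>c. ml_fps (\<upsilon> - \<mu>) \<upsilon> \<alpha>
      * (fps_const c * fps_X - fps_X * (fps_X * grid_fps (\<upsilon> - 1) h))"
    have "?P c $ n = c * e (real n - 1) - S n" if "n \<le> b + 3" for n c
      unfolding e_def S_def H_def by (rule ml_fps_times_rhs_nth[OF that])
    then have "(\<forall>n\<le>b + 3. Y n = ?P c $ n) \<longleftrightarrow> (\<forall>n\<le>b + 3. Y n = c * e (real n - 1) - S n)" for c
      by metis
    moreover have "grid_fps (\<upsilon> - 2) y $ n = Y n" for n
      by (simp add: Y_def)
    ultimately show ?thesis
      by (simp only: bvp_solution_iff_fps[OF assms(1-4) \<alpha>] fps_mult_eq_upto_iff[OF inverse])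
  qed
  also have "\<dots> \<longleftrightarrow> (\<forall>n\<le>b + 3. Y n = c * e (real n - 1) - S n)"
  proof -
    have last: "d * e (real (b + 3) - 1) - S (b + 3) = 0 \<longleftrightarrow> d = c" for d
      using nz' by (auto simp: c_def field_simps)
    show ?thesis
      using last by (metis order_refl)
  qed
  also have "\<dots> \<longleftrightarrow> (\<forall>t\<in>grid_ivl (\<upsilon> - 2) (\<upsilon> + real b + 1).
      y t = (\<Sum>s\<in>grid_ivl (\<upsilon> - 1) (\<upsilon> + real b). green \<upsilon> \<mu> \<alpha> b t s * h s))"
    by (subst grid_ivl_eq_image[where m = "b + 3"]) (auto simp: green Y_def)
  finally show ?thesis .
qed

theorem mainTheorem2:
  fixes \<upsilon> \<mu> \<alpha> :: real and b :: nat
  assumes "1 < \<upsilon>" and "\<upsilon> < 2" and "0 < \<mu>" and "\<mu> < 1" and "1 \<le> b" and "\<bar>\<alpha>\<bar> < 1"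
    and "mittag_leffler (\<upsilon> - \<mu>) \<upsilon> \<alpha> (real b + 2) \<noteq> 0"
  shows "\<forall>h :: real \<Rightarrow> real.
           bvp_solution \<upsilon> \<mu> \<alpha> b h
             (\<lambda>t. \<Sum>s\<in>grid_ivl (\<upsilon> - 1) (\<upsilon> + real b). green \<upsilon> \<mu> \<alpha> b t s * h s) \<and>
           (\<forall>y :: real \<Rightarrow> real. bvp_solution \<upsilon> \<mu> \<alpha> b h y \<longrightarrow>
              (\<forall>t\<in>grid_ivl (\<upsilon> - 2) (\<upsilon> + real b + 1).
                 y t = (\<Sum>s\<in>grid_ivl (\<upsilon> - 1) (\<upsilon> + real b). green \<upsilon> \<mu> \<alpha> b t s * h s)))"
  using bvp_solution_iff_green[OF assms(1-4,6,7)] by simp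

end
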